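(* There is no weak embedding of Scott's graph model $\mathcal{G}$ into van Oosten's model $\mathcal{B}$; that is, $\mathcal{G}\not\hookrightarrow\mathcal{B}$.
   Context: For pcas (partial applicative systems satisfying combinatory completeness) $\mathcal{A},\mathcal{C}$, a weak embedding is an injection $F:\mathcal{A}\to\mathcal{C}$ such that for all $a,b\in\mathcal{A}$: if $ab$ is defined in $\mathcal{A}$ then $F(a)F(b)$ is defined in $\mathcal{C}$ and equals $F(ab)$. Scott's graph model $\mathcal{G}$ has domain $\mathcal{P}(\omega)$ with (total) application $X\cdot Y=\{n\in\omega : \exists u\,(\langle n,u\rangle\in X \wedge D_u\subseteq Y)\}$, where $D_u$ is the finite set with canonical code $u$ and $\langle\cdot,\cdot\rangle$ is a standard pairing function. Van Oosten's model $\mathcal{B}$ has as domain all partial functions $\omega\to\omega$, with application $f\cdot g$ the partial function $n\mapsto \Phi_{f(0)}^{f\oplus g}(n)$, where $\Phi_e^Z$ is the $e$-th oracle Turing functional and an oracle computation with a partial oracle is undefined as soon as it queries a point where the oracle is undefined. *)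

theory Defs
  imports "HOL-Library.Nat_Bijection"
begin

text \<open>A partial applicative system on the domain \<^typ>\<open>'a\<close> is given by its partial application
  of type \<^typ>\<open>'a \<Rightarrow> 'a \<Rightarrow> 'a option\<close>; \<^term>\<open>None\<close> means undefined.\<close>

definition weak_embedding ::
    "('a \<Rightarrow> 'a \<Rightarrow> 'a option) \<Rightarrow> ('c \<Rightarrow> 'c \<Rightarrow> 'c option) \<Rightarrow> ('a \<Rightarrow> 'c) \<Rightarrow> bool" where
  "weak_embedding appA appC F \<longleftrightarrow>
     inj F \<and> (\<forall>a b c. appA a b = Some c \<longrightarrow> appC (F a) (F b) = Some (F c))"


section \<open>Scott's graph model\<close>

definition scott_app :: "nat set \<Rightarrow> nat set \<Rightarrow> nat set option" where
  "scott_app X Y = Some {n. \<exists>u. prod_encode (n, u) \<in> X \<and> set_decode u \<subseteq> Y}"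


section \<open>Oracle Turing machines with a partial oracle\<close>

text \<open>The machines have a work tape and a query tape, both infinite in both directions and with
  alphabet blank/mark. A tape is represented by the set of its marked cells.\<close>

datatype tape_action = Move_Left | Move_Right | Erase | Mark

datatype action = On_Work tape_action | On_Query tape_action | Ask_Oracle

text \<open>The instruction \<open>(q, a, b, act, q')\<close> applies in state \<open>q\<close> if the scanned cell of the work
  (query) tape is marked exactly when \<open>a\<close> (\<open>b\<close>) is true; it performs \<open>act\<close> and goes to
  state \<open>q'\<close>. If several instructions of a program apply, the first one is executed.\<close>

type_synonym instruction = "nat \<times> bool \<times> bool \<times> action \<times> nat"

record config =
  state :: nat
  work :: "int set"
  work_head :: int
  qtape :: "int set"
  query_head :: int

fun tape_act :: "tape_action \<Rightarrow> int set \<times> int \<Rightarrow> int set \<times> int" where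
  "tape_act Move_Left (T, i) = (T, i - 1)"
| "tape_act Move_Right (T, i) = (T, i + 1)"
| "tape_act Erase (T, i) = (T - {i}, i)"
| "tape_act Mark (T, i) = (insert i T, i)"

text \<open>The number asked for is the number of marks on the query tape. The answer \<open>y\<close> replaces the
  contents of the query tape by a block of \<open>y\<close> marks. There is no next configuration if the
  oracle is undefined at the point asked for.\<close>

fun perform :: "(nat \<Rightarrow> nat option) \<Rightarrow> action \<Rightarrow> config \<Rightarrow> config option" where
  "perform Z (On_Work t) c =
     (let (T, i) = tape_act t (work c, work_head c) in Some (c\<lparr>work := T, work_head := i\<rparr>))"
| "perform Z (On_Query t) c =
     (let (T, i) = tape_act t (qtape c, query_head c) in Some (c\<lparr>qtape := T, query_head := i\<rparr>))"
| "perform Z Ask_Oracle c =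
     map_option (\<lambda>y. c\<lparr>qtape := {0..<int y}, query_head := 0\<rparr>) (Z (card (qtape c)))"

definition applicable :: "config \<Rightarrow> instruction \<Rightarrow> bool" where
  "applicable c = (\<lambda>(q, a, b, act, q').
     q = state c \<and> a = (work_head c \<in> work c) \<and> b = (query_head c \<in> qtape c))"

definition halted :: "instruction list \<Rightarrow> config \<Rightarrow> bool" where
  "halted P c \<longleftrightarrow> find (applicable c) P = None"

inductive step :: "instruction list \<Rightarrow> (nat \<Rightarrow> nat option) \<Rightarrow> config \<Rightarrow> config \<Rightarrow> bool"
  for P Z where
  "find (applicable c) P = Some (q, a, b, act, q') \<Longrightarrow> perform Z act c = Some d \<Longrightarrow>
     step P Z c (d\<lparr>state := q'\<rparr>)"

definition initial :: "nat \<Rightarrow> config" where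
  "initial n = \<lparr>state = 0, work = {0..<int n}, work_head = 0, qtape = {}, query_head = 0\<rparr>"

definition result :: "config \<Rightarrow> nat" where
  "result c = card (work c)"

definition computes_to ::
    "instruction list \<Rightarrow> (nat \<Rightarrow> nat option) \<Rightarrow> nat \<Rightarrow> config \<Rightarrow> bool" where
  "computes_to P Z n c \<longleftrightarrow> (step P Z)\<^sup>*\<^sup>* (initial n) c \<and> halted P c"


subsection \<open>Effective numbering of the machines\<close>

definition decode_tape_action :: "nat \<Rightarrow> tape_action" where
  "decode_tape_action k = [Move_Left, Move_Right, Erase, Mark] ! (k mod 4)"

definition decode_action :: "nat \<Rightarrow> action" where
  "decode_action k =
     (if k < 4 then On_Work (decode_tape_action k)
      else if k < 8 then On_Query (decode_tape_action k)
      else Ask_Oracle)"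

definition decode_instruction :: "nat \<Rightarrow> instruction" where
  "decode_instruction k =
     (let (q, k1) = prod_decode k; (s, k2) = prod_decode k1; (act, q') = prod_decode k2
      in (q, odd s, odd (s div 2), decode_action act, q'))"

definition machine :: "nat \<Rightarrow> instruction list" where
  "machine e = map decode_instruction (list_decode e)"

lemma surj_machine: "surj machine"
proof -
  have act: "\<exists>k. decode_action k = a" for a
  proof (cases a)
    case (On_Work t)
    have "decode_action 0 = On_Work Move_Left" "decode_action 1 = On_Work Move_Right"
      "decode_action 2 = On_Work Erase" "decode_action 3 = On_Work Mark"
      by (simp_all add: decode_action_def decode_tape_action_def)
    then show ?thesis using On_Work by (cases t) blast+
  next
    case (On_Query t)
    have "decode_action 4 = On_Query Move_Left" "decode_action 5 = On_Query Move_Right"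
      "decode_action 6 = On_Query Erase" "decode_action 7 = On_Query Mark"
      by (simp_all add: decode_action_def decode_tape_action_def)
    then show ?thesis using On_Query by (cases t) blast+
  next
    case Ask_Oracle
    have "decode_action 8 = Ask_Oracle" by (simp add: decode_action_def)
    then show ?thesis using Ask_Oracle by blast
  qed
  have "\<exists>k. decode_instruction k = i" for i
  proof -
    obtain q a b ac q' where i: "i = (q, a, b, ac, q')" by (cases i) auto
    obtain k where k: "decode_action k = ac" using act by blast
    have "decode_instruction
        (prod_encode (q, prod_encode (of_bool a + 2 * of_bool b, prod_encode (k, q')))) = i"
      by (auto simp: decode_instruction_def i k)
    then show ?thesis ..
  qed
  then have "surj decode_instruction" unfolding surj_def by metis
  then have "surj (map decode_instruction)" unfolding surj_def ex_map_conv by blast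
  then show ?thesis
    unfolding machine_def surj_def by (metis list_encode_inverse)
qed

definition turing_functional :: "nat \<Rightarrow> (nat \<Rightarrow> nat option) \<Rightarrow> nat \<Rightarrow> nat option" where
  "turing_functional e Z n =
     (if \<exists>c. computes_to (machine e) Z n c
      then Some (result (THE c. computes_to (machine e) Z n c)) else None)"

lemma step_deterministic: "step P Z c d \<Longrightarrow> step P Z c d' \<Longrightarrow> d = d'"
  by (auto elim!: step.cases)

lemma halted_no_step: "halted P c \<Longrightarrow> \<not> step P Z c d"
  by (auto simp: halted_def elim: step.cases)

lemma computes_to_unique:
  assumes "computes_to P Z n c" "computes_to P Z n d"
  shows "c = d"
proof -
  have "(step P Z)\<^sup>*\<^sup>* x c \<Longrightarrow> (step P Z)\<^sup>*\<^sup>* x d \<Longrightarrow> c = d" for x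
  proof (induction rule: converse_rtranclp_induct)
    case base
    then show ?case
      using assms(1) by (auto simp: computes_to_def dest: halted_no_step elim: converse_rtranclpE)
  next
    case (step x y)
    from \<open>(step P Z)\<^sup>*\<^sup>* x d\<close> show ?case
    proof (cases rule: converse_rtranclpE)
      case base
      then show ?thesis using assms(2) step.hyps(1) by (auto simp: computes_to_def dest: halted_no_step)
    next
      case (step z)
      then show ?thesis using step.IH \<open>step P Z x y\<close> step_deterministic by metis
    qed
  qed
  then show ?thesis using assms by (auto simp: computes_to_def)
qed

lemma turing_functional_eq_Some_iff:
  "turing_functional e Z n = Some k \<longleftrightarrow> (\<exists>c. computes_to (machine e) Z n c \<and> result c = k)"
proof -
  have "(THE d. computes_to (machine e) Z n d) = c" if "computes_to (machine e) Z n c" for c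
    using that computes_to_unique by blast
  then show ?thesis
    unfolding turing_functional_def by auto
qed


section \<open>Van Oosten's model\<close>

definition join :: "(nat \<Rightarrow> nat option) \<Rightarrow> (nat \<Rightarrow> nat option) \<Rightarrow> nat \<Rightarrow> nat option"
    (infixl "\<oplus>" 65) where
  "(f \<oplus> g) k = (if even k then f (k div 2) else g (k div 2))"

text \<open>If \<open>f 0\<close> is undefined, \<open>f \<cdot> g\<close> is the nowhere defined function; application itself is
  total.\<close>

definition oosten_app ::
    "(nat \<Rightarrow> nat option) \<Rightarrow> (nat \<Rightarrow> nat option) \<Rightarrow> (nat \<Rightarrow> nat option) option" where
  "oosten_app f g =
     Some (\<lambda>n. case f 0 of None \<Rightarrow> None | Some e \<Rightarrow> turing_functional e (f \<oplus> g) n)"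

end

theory Submission
  imports Defs "HOL-Analysis.Continuum_Not_Denumerable"
begin

text \<open>Every \<open>X \<mapsto> (if X \<subseteq> B then S else T)\<close> with \<open>S \<subseteq> T\<close> is represented in the graph model.
  If a weak embedding \<open>F\<close> had \<open>F S\<close> defined at some \<open>n\<close> where \<open>F T\<close> does not have the same value,
  then the finite part of \<open>F B\<close> used in computing the value at \<open>n\<close> would separate \<open>B\<close> from all its
  proper supersets, for every \<open>B\<close>. An uncountable chain of sets \<open>B\<close> makes this impossible, as there
  are only countably many finite parts. So \<open>F\<close> is monotone. Now let \<open>F {0}\<close> be defined at \<open>n\<close> and
  \<open>F {}\<close> not. The sequential computation of the value at \<open>n\<close> gets stuck on \<open>F B\<close> at a query \<open>m\<close>
  which is answered by \<open>F X\<close> for all proper supersets \<open>X\<close> of \<open>B\<close>. Again \<open>m\<close> is the same for two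
  members of the chain, a contradiction.\<close>

section \<open>Uncountable chains of sets and threshold functions in the graph model\<close>

text \<open>The Dedekind cuts, with rationals coded by naturals, form a chain indexed by the reals.
  A function into a countable type must identify two of them.\<close>

lemma countable_valued_not_inj_on_chains:
  fixes f :: "nat set \<Rightarrow> 'b::countable"
  shows "\<exists>B C. B \<subset> C \<and> f B = f C"
proof -
  define cut where "cut r = {n. of_rat (from_nat n) < r}" for r :: real
  have "\<not> inj (f \<circ> cut)"
  proof
    assume "inj (f \<circ> cut)"
    then have "countable (UNIV :: real set)"
      by (metis countableI_type countable_image_inj_on)
    then show False
      using uncountable_UNIV_real by blast
  qed
  then obtain r s where rs: "r < s" "f (cut r) = f (cut s)"
    unfolding inj_def o_def by (metis linorder_neqE)
  from \<open>r < s\<close> obtain q where "r < of_rat q" "of_rat q < s"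
    using of_rat_dense by blast
  then have "to_nat q \<in> cut s - cut r"
    by (simp add: cut_def)
  moreover have "cut r \<subseteq> cut s"
    using \<open>r < s\<close> by (auto simp: cut_def)
  ultimately show ?thesis
    using rs(2) by blast
qed

text \<open>Members of \<open>S\<close> need no information about the argument and come with every
  code, in particular the code 0 of the empty set. The other members of \<open>T\<close> require a
  finite part that escapes \<open>B\<close>; a singleton suffices for that.\<close>

lemma scott_app_threshold:
  assumes "S \<subseteq> T"
  shows "\<exists>A. \<forall>X. scott_app A X = Some (if X \<subseteq> B then S else T)"
proof -
  define A where
    "A = {prod_encode (n, u) | n u. n \<in> S \<or> n \<in> T \<and> \<not> set_decode u \<subseteq> B}"
  have A: "prod_encode (n, u) \<in> A \<longleftrightarrow> n \<in> S \<or> n \<in> T \<and> \<not> set_decode u \<subseteq> B" for n u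
    by (auto simp: A_def)
  have "{n. \<exists>u. prod_encode (n, u) \<in> A \<and> set_decode u \<subseteq> X} = (if X \<subseteq> B then S else T)" for X
  proof (cases "X \<subseteq> B")
    case True
    moreover have "set_decode 0 \<subseteq> X"
      by simp
    ultimately show ?thesis
      unfolding A by (auto intro: exI[of _ 0])
  next
    case False
    then obtain x where x: "x \<in> X" "x \<notin> B"
      by blast
    moreover have "set_decode (set_encode {x}) = {x}"
      by (rule set_encode_inverse) simp
    ultimately have "set_decode (set_encode {x}) \<subseteq> X" "\<not> set_decode (set_encode {x}) \<subseteq> B"
      by (simp_all only: insert_subset empty_subsetI simp_thms)
    then show ?thesis
      unfolding A using False assms by (auto intro!: exI[of _ "set_encode {x}"])
  qed
  then show ?thesis
    unfolding scott_app_def by (intro exI[of _ A]) simp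
qed

section \<open>Finite use and sequentiality of oracle computations\<close>

lemma perform_cong:
  assumes "Z (card (qtape c)) = Z' (card (qtape c))"
  shows "perform Z act c = perform Z' act c"
  using assms by (cases act) simp_all

lemma step_cong:
  assumes "step P Z c d" "Z (card (qtape c)) = Z' (card (qtape c))"
  shows "step P Z' c d"
  using assms by (metis perform_cong step.simps)

lemma perform_mono:
  assumes "perform Z act c = Some d" "Z \<subseteq>\<^sub>m Z'"
  shows "perform Z' act c = Some d"
  using assms by (cases act) (auto simp: map_le_def dom_def)

lemma step_mono:
  assumes "step P Z c d" "Z \<subseteq>\<^sub>m Z'"
  shows "step P Z' c d"
  using assms by (metis perform_mono step.simps)

text \<open>A single step from \<open>y\<close> consults the oracle at most at
  \<open>card (qtape y)\<close>, so the bound grows by finitely much with each step.\<close>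

lemma steps_finite_use:
  assumes "(step P Z)\<^sup>*\<^sup>* c d"
  shows "\<exists>k. \<forall>Z'. (\<forall>i<k. Z i = Z' i) \<longrightarrow> (step P Z')\<^sup>*\<^sup>* c d"
  using assms
proof (induction rule: rtranclp_induct)
  case base
  then show ?case by blast
next
  case (step y z)
  then obtain k where k: "\<And>Z'. \<forall>i<k. Z i = Z' i \<Longrightarrow> (step P Z')\<^sup>*\<^sup>* c y"
    by blast
  have "(step P Z')\<^sup>*\<^sup>* c z" if "\<forall>i<max k (Suc (card (qtape y))). Z i = Z' i" for Z'
  proof -
    have "(step P Z')\<^sup>*\<^sup>* c y"
      using that by (blast intro: k less_max_iff_disj[THEN iffD2])
    moreover have "step P Z' y z"
      using step.hyps(2) that by (metis step_cong less_max_iff_disj lessI)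
    ultimately show ?thesis
      by (rule rtranclp.rtrancl_into_rtrancl)
  qed
  then show ?case by blast
qed

lemma turing_functional_finite_use:
  assumes "turing_functional e Z n = Some a"
  shows "\<exists>k. \<forall>Z'. (\<forall>i<k. Z i = Z' i) \<longrightarrow> turing_functional e Z' n = Some a"
  using assms steps_finite_use
  unfolding turing_functional_eq_Some_iff computes_to_def by metis

text \<open>By monotonicity and determinism, any step possible with \<open>Z\<close> is the step
  taken with \<open>Z'\<close>. The run with \<open>Z\<close> thus follows the other one to its end
  or until it gets stuck.\<close>

lemma steps_halt_or_stuck:
  assumes "(step P Z')\<^sup>*\<^sup>* c d" "halted P d" "Z \<subseteq>\<^sub>m Z'"
  shows "(step P Z)\<^sup>*\<^sup>* c d \<or>
    (\<exists>c'. (step P Z)\<^sup>*\<^sup>* c c' \<and> \<not> halted P c' \<and> (\<nexists>x. step P Z c' x))"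
  using assms(1)
proof (induction rule: converse_rtranclp_induct)
  case base
  then show ?case by blast
next
  case (step c y)
  show ?case
  proof (cases "\<exists>x. step P Z c x")
    case True
    then have "step P Z c y"
      using step.hyps(1) step_mono[OF _ assms(3)] step_deterministic by metis
    then show ?thesis
      using step.IH by (meson converse_rtranclp_into_rtranclp)
  next
    case False
    then show ?thesis
      using step.hyps(1) halted_no_step by blast
  qed
qed

lemma steps_to_halted_through:
  assumes "(step P Z)\<^sup>*\<^sup>* c c'" "(step P Z)\<^sup>*\<^sup>* c d" "halted P d"
  shows "(step P Z)\<^sup>*\<^sup>* c' d"
  using assms(1)
proof (induction rule: rtranclp_induct)
  case base
  then show ?case by (rule assms(2))
next
  case (step y z)
  from step.IH show ?case
  proof (cases rule: converse_rtranclpE)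
    case base
    then show ?thesis
      using step.hyps(2) assms(3) halted_no_step by blast
  next
    case (step w)
    then show ?thesis
      using \<open>step P Z y z\<close> step_deterministic by metis
  qed
qed

text \<open>Sequentiality: the query does not depend on the extension of the oracle.\<close>

lemma turing_functional_sequential:
  assumes undef: "turing_functional e Z n = None"
    and "Z\<^sub>0 \<in> \<Z>"
    and ext: "\<And>Z'. Z' \<in> \<Z> \<Longrightarrow> Z \<subseteq>\<^sub>m Z' \<and> turing_functional e Z' n \<noteq> None"
  shows "\<exists>q. Z q = None \<and> (\<forall>Z'\<in>\<Z>. Z' q \<noteq> None)"
proof -
  let ?P = "machine e"
  have halts: "\<exists>d. (step ?P Z')\<^sup>*\<^sup>* (initial n) d \<and> halted ?P d" if "Z' \<in> \<Z>" for Z'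
    using ext[OF that] turing_functional_eq_Some_iff unfolding computes_to_def by fastforce
  obtain d where d: "(step ?P Z\<^sub>0)\<^sup>*\<^sup>* (initial n) d" "halted ?P d"
    using halts \<open>Z\<^sub>0 \<in> \<Z>\<close> by blast
  have "\<not> (step ?P Z)\<^sup>*\<^sup>* (initial n) d"
    using undef d(2) turing_functional_eq_Some_iff[of e Z n "result d"]
    unfolding computes_to_def by auto
  \<comment> \<open>The stuck configuration \<open>c\<close> is reached with \<open>Z\<close> alone,
    so its query serves every extension in the family.\<close>
  then obtain c where c: "(step ?P Z)\<^sup>*\<^sup>* (initial n) c" "\<not> halted ?P c" "\<nexists>x. step ?P Z c x"
    using steps_halt_or_stuck[OF d] ext \<open>Z\<^sub>0 \<in> \<Z>\<close> by blast
  have query: "Z (card (qtape c)) = None \<and> Z' (card (qtape c)) \<noteq> None" if Z': "Z' \<in> \<Z>" for Z'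
  proof -
    have le: "Z \<subseteq>\<^sub>m Z'"
      using ext Z' by blast
    obtain d' where d': "(step ?P Z')\<^sup>*\<^sup>* (initial n) d'" "halted ?P d'"
      using halts Z' by blast
    have "(step ?P Z')\<^sup>*\<^sup>* (initial n) c"
      using c(1) step_mono[OF _ le] by (metis mono_rtranclp)
    then have "(step ?P Z')\<^sup>*\<^sup>* c d'"
      using d' by (rule steps_to_halted_through)
    then obtain x where "step ?P Z' c x"
      using c(2) d'(2) by (metis converse_rtranclpE)
    \<comment> \<open>A step depends on the oracle only at this point, and \<open>c\<close> has a
      successor with \<open>Z'\<close> but none with \<open>Z\<close>. As \<open>Z'\<close> extends
      \<open>Z\<close>, differing there means that \<open>Z\<close> is undefined.\<close>
    then have "Z (card (qtape c)) \<noteq> Z' (card (qtape c))"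
      using c(3) step_cong[of ?P Z' c x Z] by metis
    then show ?thesis
      using le unfolding map_le_def dom_def by (cases "Z (card (qtape c))") auto
  qed
  then show ?thesis
    using \<open>Z\<^sub>0 \<in> \<Z>\<close> by blast
qed

section \<open>Transfer to application in van Oosten's model\<close>

lemma oosten_app_eq_Some_iff:
  "oosten_app f g = Some h \<longleftrightarrow>
     h = (\<lambda>n. case f 0 of None \<Rightarrow> None | Some e \<Rightarrow> turing_functional e (f \<oplus> g) n)"
  by (auto simp: oosten_app_def)

lemma join_mono_right:
  assumes "g \<subseteq>\<^sub>m g'"
  shows "f \<oplus> g \<subseteq>\<^sub>m f \<oplus> g'"
  using assms by (auto simp: map_le_def join_def dom_def)

lemma oosten_app_finite_use:
  assumes "oosten_app f g = Some h" "h n = Some a"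
  shows "\<exists>k. \<forall>g' h'. (\<forall>i<k. g i = g' i) \<longrightarrow> oosten_app f g' = Some h' \<longrightarrow> h' n = Some a"
proof -
  obtain e where e: "f 0 = Some e" "turing_functional e (f \<oplus> g) n = Some a"
    using assms by (auto simp: oosten_app_eq_Some_iff split: option.splits)
  then obtain k where k: "\<And>Z. \<forall>i<k. (f \<oplus> g) i = Z i \<Longrightarrow> turing_functional e Z n = Some a"
    using turing_functional_finite_use by blast
  have "turing_functional e (f \<oplus> g') n = Some a" if "\<forall>i<k. g i = g' i" for g'
    \<comment> \<open>Below \<open>k\<close> the join reads its right part only at
      \<open>i div 2\<close>, which is again below \<open>k\<close>.\<close>
    by (rule k) (use that in \<open>auto simp: join_def\<close>)
  then show ?thesis
    using e(1) by (auto simp: oosten_app_eq_Some_iff)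
qed

lemma oosten_app_sequential:
  assumes "oosten_app f g = Some h" "h n = None"
    and "g\<^sub>0 \<in> G"
    and ext: "\<And>g'. g' \<in> G \<Longrightarrow> g \<subseteq>\<^sub>m g' \<and> (\<exists>h'. oosten_app f g' = Some h' \<and> h' n \<noteq> None)"
  shows "\<exists>m. g m = None \<and> (\<forall>g'\<in>G. g' m \<noteq> None)"
proof -
  obtain e where e: "f 0 = Some e"
    using ext[OF \<open>g\<^sub>0 \<in> G\<close>] by (auto simp: oosten_app_eq_Some_iff split: option.splits)
  have "turing_functional e (f \<oplus> g) n = None"
    using assms(1,2) e by (simp add: oosten_app_eq_Some_iff)
  moreover have "f \<oplus> g\<^sub>0 \<in> (\<oplus>) f ` G"
    using \<open>g\<^sub>0 \<in> G\<close> by blast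
  moreover have "f \<oplus> g \<subseteq>\<^sub>m Z' \<and> turing_functional e Z' n \<noteq> None" if "Z' \<in> (\<oplus>) f ` G" for Z'
    using that ext e join_mono_right by (auto simp: oosten_app_eq_Some_iff)
  ultimately have "\<exists>q. (f \<oplus> g) q = None \<and> (\<forall>Z'\<in>(\<oplus>) f ` G. Z' q \<noteq> None)"
    by (rule turing_functional_sequential)
  then obtain q where q: "(f \<oplus> g) q = None" "\<And>g'. g' \<in> G \<Longrightarrow> (f \<oplus> g') q \<noteq> None"
    by (metis image_eqI)
  \<comment> \<open>At even points both joins return the value of \<open>f\<close>, so they could
    not differ in definedness.\<close>
  then have "odd q"
    using \<open>g\<^sub>0 \<in> G\<close> unfolding join_def by metis
  then have "g (q div 2) = None" "\<And>g'. g' \<in> G \<Longrightarrow> g' (q div 2) \<noteq> None"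
    using q unfolding join_def by metis+
  then show ?thesis
    by blast
qed

section \<open>Weak embeddings of the graph model\<close>

lemma weak_embedding_mono:
  assumes F: "weak_embedding scott_app oosten_app F" and "S \<subseteq> T"
  shows "F S \<subseteq>\<^sub>m F T"
proof (rule ccontr)
  assume "\<not> F S \<subseteq>\<^sub>m F T"
  then obtain n a where n: "F S n = Some a" "F T n \<noteq> Some a"
    unfolding map_le_def dom_def by force
  have "\<exists>k. \<forall>C. B \<subset> C \<longrightarrow> \<not> (\<forall>i<k. F B i = F C i)" for B
  proof -
    obtain A where "\<And>X. scott_app A X = Some (if X \<subseteq> B then S else T)"
      using scott_app_threshold[OF \<open>S \<subseteq> T\<close>] by blast
    then have A: "oosten_app (F A) (F X) = Some (F (if X \<subseteq> B then S else T))" for X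
      using F unfolding weak_embedding_def by blast
    have "oosten_app (F A) (F B) = Some (F S)"
      using A[of B] by simp
    then obtain k where k: "\<And>g' h'. \<forall>i<k. F B i = g' i \<Longrightarrow>
        oosten_app (F A) g' = Some h' \<Longrightarrow> h' n = Some a"
      using oosten_app_finite_use[of "F A" "F B" "F S" n a] n(1) by metis
    have "oosten_app (F A) (F C) = Some (F T)" if "B \<subset> C" for C
      using A[of C] that by (simp add: not_le less_le_not_le)
    then show ?thesis
      using k n(2) by blast
  qed
  then have "\<exists>k. \<forall>B C. B \<subset> C \<longrightarrow> \<not> (\<forall>i<k B. F B i = F C i)"
    by (intro choice allI)
  then obtain k where k: "\<And>B C. B \<subset> C \<Longrightarrow> \<not> (\<forall>i<k B. F B i = F C i)"
    by blast
  \<comment> \<open>Lists over \<open>nat option\<close> form a countable type. The length records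
    \<open>k B\<close>, so equal lists give equal bounds as well as equal initial segments.\<close>
  obtain B C where "B \<subset> C" and eq: "map (F B) [0..<k B] = map (F C) [0..<k C]"
    using countable_valued_not_inj_on_chains[of "\<lambda>B. map (F B) [0..<k B]"] by blast
  have "k B = k C"
    using eq by (metis length_map length_upt minus_nat.diff_0)
  then have "\<forall>i<k B. F B i = F C i"
    using eq by simp
  then show False
    using k[OF \<open>B \<subset> C\<close>] by blast
qed

theorem theorem2p2: "\<not> (\<exists>F. weak_embedding scott_app oosten_app F)"
proof
  assume "\<exists>F. weak_embedding scott_app oosten_app F"
  then obtain F where F: "weak_embedding scott_app oosten_app F"
    by blast
  have "F {} \<noteq> F {0}"
    using F by (auto simp: weak_embedding_def inj_def)
  moreover have "F {} \<subseteq>\<^sub>m F {0}"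
    using weak_embedding_mono[OF F] by simp
  ultimately obtain n where n: "F {} n = None" "F {0} n \<noteq> None"
    by (metis domIff ext map_le_def)
  have "\<exists>m. B \<noteq> UNIV \<longrightarrow> F B m = None \<and> (\<forall>C. B \<subset> C \<longrightarrow> F C m \<noteq> None)" for B
  proof (cases "B = UNIV")
    case False
    obtain A where "\<And>X. scott_app A X = Some (if X \<subseteq> B then {} else {0})"
      using scott_app_threshold[of "{}" "{0}"] by blast
    then have A: "oosten_app (F A) (F X) = Some (F (if X \<subseteq> B then {} else {0}))" for X
      using F unfolding weak_embedding_def by blast
    have "oosten_app (F A) (F B) = Some (F {})"
      using A[of B] by simp
    moreover note n(1)
    \<comment> \<open>Sequentiality needs a nonempty family of extensions, which is why
      \<open>B = UNIV\<close> is set apart.\<close>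
    moreover have "F UNIV \<in> F ` {C. B \<subset> C}"
      using False by blast
    moreover have "F B \<subseteq>\<^sub>m g \<and> (\<exists>h. oosten_app (F A) g = Some h \<and> h n \<noteq> None)"
      if g: "g \<in> F ` {C. B \<subset> C}" for g
    proof -
      obtain C where C: "B \<subset> C" "g = F C"
        using g by blast
      then have "oosten_app (F A) g = Some (F {0})"
        using A[of C] by (simp add: less_le_not_le)
      then show ?thesis
        using n(2) C weak_embedding_mono[OF F, of B C] by blast
    qed
    ultimately have "\<exists>m. F B m = None \<and> (\<forall>g\<in>F ` {C. B \<subset> C}. g m \<noteq> None)"
      by (rule oosten_app_sequential)
    then show ?thesis
      by simp
  qed simp
  then have "\<exists>m. \<forall>B. B \<noteq> UNIV \<longrightarrow> F B (m B) = None \<and> (\<forall>C. B \<subset> C \<longrightarrow> F C (m B) \<noteq> None)"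
    by (intro choice allI)
  then obtain m where m: "\<And>B. B \<noteq> UNIV \<Longrightarrow>
      F B (m B) = None \<and> (\<forall>C. B \<subset> C \<longrightarrow> F C (m B) \<noteq> None)"
    by blast
  \<comment> \<open>The Boolean component keeps \<open>C\<close> different from \<open>UNIV\<close>,
    where \<open>m\<close> carries no information.\<close>
  obtain B C where "B \<subset> C" and eq: "(B = UNIV, m B) = (C = UNIV, m C)"
    using countable_valued_not_inj_on_chains[of "\<lambda>B. (B = UNIV, m B)"] by blast
  have "C \<noteq> UNIV"
  proof
    assume "C = UNIV"
    with eq have "B = UNIV"
      by blast
    with \<open>B \<subset> C\<close> show False
      by blast
  qed
  moreover have "B \<noteq> UNIV"
    using \<open>B \<subset> C\<close> by blast
  \<comment> \<open>\<open>F C\<close> is stuck at its own query \<open>m C\<close>, but answers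
    \<open>m B\<close> because \<open>C\<close> properly extends \<open>B\<close>.\<close>
  ultimately have "F C (m C) = None" "F C (m B) \<noteq> None"
    using m \<open>B \<subset> C\<close> by blast+
  moreover have "m B = m C"
    using eq by (rule Pair_inject)
  ultimately show False
    by metis
qed

end
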